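(* Let $n\ge 2$ and let $u:\mathbb{R}^n\to\mathbb{R}$ be a concave solution of $-\Delta u=e^{2u}$ in $\mathbb{R}^n$. Assume further that $u$ has a local maximum at some point $x_0\in\mathbb{R}^n$. Then, up to translation, rotation and scaling, $u=\ln(\operatorname{sech}x_n)$; that is, there exist $\lambda>0$, a rotation $R$ of $\mathbb{R}^n$ and $b\in\mathbb{R}^n$ such that $u(x)=\ln\lambda+U(\lambda Rx+b)$ for all $x\in\mathbb{R}^n$, where $U(x)=\ln(\operatorname{sech}x_n)$.
   Context: A solution means a classical ($C^2$) real-valued solution on all of $\mathbb{R}^n$; $x_n$ denotes the last coordinate of $x\in\mathbb{R}^n$. *)

theory Defs
  imports "HOL-Analysis.Analysis"
begin

text \<open>Partial derivatives are read off the Frechet derivative; they are only meaningful at points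
  of differentiability, which \<open>C1\<close> and \<open>C2\<close> below guarantee wherever they are used.\<close>

definition partial_deriv :: "'n \<Rightarrow> (real ^ 'n \<Rightarrow> real) \<Rightarrow> real ^ 'n \<Rightarrow> real" where
  "partial_deriv i f x = frechet_derivative f (at x) (axis i 1)"

definition C1 :: "(real ^ 'n \<Rightarrow> real) \<Rightarrow> bool" where
  "C1 f \<longleftrightarrow> (\<forall>x. f differentiable (at x)) \<and> (\<forall>i. continuous_on UNIV (partial_deriv i f))"

definition C2 :: "(real ^ 'n \<Rightarrow> real) \<Rightarrow> bool" where
  "C2 f \<longleftrightarrow> C1 f \<and> (\<forall>i. C1 (partial_deriv i f))"

definition laplacian :: "(real ^ 'n \<Rightarrow> real) \<Rightarrow> real ^ 'n \<Rightarrow> real" where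
  "laplacian f x = (\<Sum>i\<in>UNIV. partial_deriv i (partial_deriv i f) x)"

definition is_solution :: "(real ^ 'n \<Rightarrow> real) \<Rightarrow> bool" where
  "is_solution u \<longleftrightarrow> C2 u \<and> (\<forall>x. - laplacian u x = exp (2 * u x))"

definition has_local_max_at :: "(real ^ 'n \<Rightarrow> real) \<Rightarrow> real ^ 'n \<Rightarrow> bool" where
  "has_local_max_at u x0 \<longleftrightarrow> (\<forall>\<^sub>F x in nhds x0. u x \<le> u x0)"

definition sech :: "real \<Rightarrow> real" where
  "sech t = 1 / cosh t"

text \<open>The index type is linearly ordered so that the last coordinate of \<open>x\<close> is the one with the
  largest index.\<close>

definition U_sech :: "real ^ 'n::{finite,linorder} \<Rightarrow> real" where
  "U_sech x = ln (sech (x $ Max UNIV))"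

end

theory Submission
  imports Defs "HOL-Real_Asymp.Real_Asymp"
begin

text \<open>
The proof compares \<open>u\<close> with two explicit barriers, and concavity supplies the global control that the
comparisons need. By concavity the local maximum at \<open>x0\<close> is a global one.

First, a ray of maxima starting at \<open>x0\<close> forces invariance. If \<open>u\<close> equals its maximum along the whole
ray in direction \<open>e\<close>, concavity makes \<open>u\<close> nondecreasing in direction \<open>e\<close> everywhere. The increment
\<open>u (x + t e) - u x\<close> is then nonnegative and superharmonic, since its Laplacian is
\<open>exp (2 u x) - exp (2 u (x + t e))\<close>, and it vanishes at \<open>x0\<close>; the strong minimum principle shows
that it vanishes identically (\<open>strong_minimum_principle\<close>, \<open>invariant_along_ray_of_maxima\<close>).

Secondly, let \<open>V\<close> be the orthogonal complement of the space of all directions in which \<open>u\<close> is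
invariant. By the first step there is no ray of maxima in \<open>x0 + V\<close>, and concavity turns this into
linear decay of \<open>u\<close> on \<open>x0 + V\<close> (\<open>concave_linear_decay\<close>). Then \<open>exp (2 u)\<close> is exponentially small,
which is too little curvature for a function that decays linearly in two or more dimensions: if \<open>V\<close>
contained orthonormal vectors, adding a large multiple of \<open>ln (1 + r\<^sup>2)\<close>, with \<open>r\<close> the distance in the
two corresponding coordinates, would give a function with positive Laplacian and a global maximum
(\<open>no_linear_decay_in_two_directions\<close>). Hence \<open>V\<close> is a line and \<open>u x = f (a \<bullet> x)\<close> for a unit vector
\<open>a\<close> (\<open>solution_one_dimensional\<close>).

Finally \<open>f'' = - exp (2 f)\<close>, and \<open>exp (- f)\<close> solves a linear equation whose solution is a hyperbolic
cosine (\<open>ode_with_critical_point\<close>). A rotation taking \<open>a\<close> to the last basis vector gives the claim.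
\<close>

section \<open>Pure second partial derivatives\<close>

text \<open>Only the unmixed derivatives enter a Laplacian, and these are derivatives of restrictions to
coordinate lines. Carrying the functions \<open>g\<close> and \<open>h\<close> explicitly lets the
Laplacian of a sum, of a translate or of an explicit barrier be read off as \<open>\<Sum>i. h i
x\<close>, with all calculus done in one variable.\<close>
definition has_pure_partials ::
    "(real ^ 'n \<Rightarrow> real) \<Rightarrow> ('n \<Rightarrow> real ^ 'n \<Rightarrow> real) \<Rightarrow> ('n \<Rightarrow> real ^ 'n \<Rightarrow> real) \<Rightarrow> bool" where
  "has_pure_partials w g h \<longleftrightarrow>
     (\<forall>i x. ((\<lambda>t. w (x + t *\<^sub>R axis i 1)) has_real_derivative g i x) (at 0) \<and>
            ((\<lambda>t. g i (x + t *\<^sub>R axis i 1)) has_real_derivative h i x) (at 0))"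

lemma has_pure_partials_slice:
  assumes "has_pure_partials w g h"
  shows "((\<lambda>t. w (x + t *\<^sub>R axis i 1)) has_real_derivative g i (x + t *\<^sub>R axis i 1)) (at t)"
    and "((\<lambda>t. g i (x + t *\<^sub>R axis i 1)) has_real_derivative h i (x + t *\<^sub>R axis i 1)) (at t)"
proof -
  have *: "x + t *\<^sub>R axis i 1 + s *\<^sub>R axis i 1 = x + (s + t) *\<^sub>R axis i 1" for s
    by (simp add: algebra_simps)
  show "((\<lambda>t. w (x + t *\<^sub>R axis i 1)) has_real_derivative g i (x + t *\<^sub>R axis i 1)) (at t)"
    and "((\<lambda>t. g i (x + t *\<^sub>R axis i 1)) has_real_derivative h i (x + t *\<^sub>R axis i 1)) (at t)"
    using assms[unfolded has_pure_partials_def, rule_format, of "x + t *\<^sub>R axis i 1" i, unfolded *]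
      DERIV_shift[of "\<lambda>t. w (x + t *\<^sub>R axis i 1)" _ 0 t]
      DERIV_shift[of "\<lambda>t. g i (x + t *\<^sub>R axis i 1)" _ 0 t]
    by simp_all
qed

lemma has_pure_partials_add_scaled:
  assumes "has_pure_partials w g h" "has_pure_partials w' g' h'"
  shows "has_pure_partials (\<lambda>x. w x + c * w' x) (\<lambda>i x. g i x + c * g' i x) (\<lambda>i x. h i x + c * h' i x)"
  using assms unfolding has_pure_partials_def
  by (auto intro!: DERIV_add DERIV_cmult)

lemma has_pure_partials_minus:
  assumes "has_pure_partials w g h"
  shows "has_pure_partials (\<lambda>x. - w x) (\<lambda>i x. - g i x) (\<lambda>i x. - h i x)"
  using assms unfolding has_pure_partials_def
  by (auto intro!: DERIV_minus)

lemma has_pure_partials_translate: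
  assumes "has_pure_partials w g h"
  shows "has_pure_partials (\<lambda>x. w (x + v)) (\<lambda>i x. g i (x + v)) (\<lambda>i x. h i (x + v))"
  unfolding has_pure_partials_def
proof (intro allI)
  fix i x
  have *: "x + t *\<^sub>R axis i 1 + v = (x + v) + t *\<^sub>R axis i 1" for t
    by (simp add: algebra_simps)
  show "((\<lambda>t. w (x + t *\<^sub>R axis i 1 + v)) has_real_derivative g i (x + v)) (at 0) \<and>
      ((\<lambda>t. g i (x + t *\<^sub>R axis i 1 + v)) has_real_derivative h i (x + v)) (at 0)"
    unfolding * using assms unfolding has_pure_partials_def by blast
qed

section \<open>The Laplacian at a maximum\<close>

text \<open>If the second derivative \<open>m\<close> were positive, \<open>f'\<close> would be positive
immediately to the right of its zero \<open>s\<close>, so \<open>f\<close> would increase there.\<close>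
lemma second_derivative_nonpos_at_max:
  fixes f f' :: "real \<Rightarrow> real"
  assumes f: "\<And>t. (f has_real_derivative f' t) (at t)"
    and f': "(f' has_real_derivative m) (at s)"
    and max: "eventually (\<lambda>t. f t \<le> f s) (nhds s)"
  shows "m \<le> 0"
proof (rule ccontr)
  assume "\<not> m \<le> 0"
  obtain d where d: "d > 0" "\<And>t. \<bar>s - t\<bar> < d \<Longrightarrow> f t \<le> f s"
    using max unfolding eventually_nhds_metric by (auto simp: dist_real_def abs_minus_commute)
  have "f' s = 0"
    using DERIV_local_max[OF f d(1)] d(2) by blast
  obtain d' where d': "d' > 0" "\<And>h. 0 < h \<Longrightarrow> h < d' \<Longrightarrow> f' s < f' (s + h)"
    using DERIV_pos_inc_right[OF f'] \<open>\<not> m \<le> 0\<close> by auto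
  define e where "e = min d d' / 2"
  have e: "0 < e" "e < d" "e < d'"
    using d d' by (auto simp: e_def)
  obtain z where "s < z" "z < s + e" "f (s + e) - f s = (s + e - s) * f' z"
    using MVT2[of s "s + e" f f'] f e by auto
  moreover have "f' z > 0"
    using d'(2)[of "z - s"] \<open>f' s = 0\<close> \<open>s < z\<close> \<open>z < s + e\<close> e by simp
  ultimately have "f (s + e) > f s"
    using e by (smt (verit) mult_pos_pos)
  then show False
    using d(2)[of "s + e"] e by auto
qed

text \<open>The one maximum principle on which every comparison argument below rests: apply the
second-derivative test on each coordinate line separately.\<close>
lemma sum_pure_partials_nonpos_at_max:
  fixes w :: "real ^ 'n \<Rightarrow> real"
  assumes w: "has_pure_partials w g h"
    and max: "eventually (\<lambda>y. w y \<le> w x) (nhds x)"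
  shows "(\<Sum>i\<in>UNIV. h i x) \<le> 0"
proof (rule sum_nonpos)
  fix i :: 'n
  have lim: "((\<lambda>t. x + t *\<^sub>R axis i 1) \<longlongrightarrow> x) (nhds (0::real))"
    by (rule tendsto_eq_intros tendsto_ident_at filterlim_ident | simp)+
  have "eventually (\<lambda>t. w (x + t *\<^sub>R axis i 1) \<le> w x) (nhds (0::real))"
    using eventually_compose_filterlim[OF max lim] .
  then show "h i x \<le> 0"
    using second_derivative_nonpos_at_max[where s=0, OF has_pure_partials_slice(1)[OF w, where x=x and i=i]
        has_pure_partials_slice(2)[OF w, where x=x and i=i]] by simp
qed

section \<open>Solutions have pure second partial derivatives\<close>

lemma partial_deriv_slice:
  assumes "f differentiable (at x)"
  shows "((\<lambda>t. f (x + t *\<^sub>R axis i 1)) has_real_derivative partial_deriv i f x) (at 0)"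
proof -
  let ?D = "frechet_derivative f (at x)"
  have "(f has_derivative ?D) (at (x + 0 *\<^sub>R axis i 1))"
    using assms frechet_derivative_works by auto
  moreover have "((\<lambda>t::real. x + t *\<^sub>R axis i 1) has_derivative (\<lambda>t. t *\<^sub>R axis i 1)) (at 0)"
    by (auto intro!: derivative_eq_intros)
  ultimately have "((\<lambda>t. f (x + t *\<^sub>R axis i 1)) has_derivative (\<lambda>t. ?D (t *\<^sub>R axis i 1))) (at 0)"
    by (rule has_derivative_compose[rotated])
  moreover have "?D (t *\<^sub>R axis i 1) = t * partial_deriv i f x" for t
    using linear_scale[OF linear_frechet_derivative[OF assms]] by (simp add: partial_deriv_def)
  ultimately show ?thesis
    unfolding has_field_derivative_def by (simp add: mult.commute[of _ "partial_deriv i f x"])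
qed

lemma C2_has_pure_partials:
  assumes "C2 u"
  shows "has_pure_partials u (\<lambda>i. partial_deriv i u) (\<lambda>i. partial_deriv i (partial_deriv i u))"
  using assms unfolding has_pure_partials_def C2_def C1_def
  by (auto intro!: partial_deriv_slice)

section \<open>Two explicit barriers\<close>

text \<open>Hopf's barrier. For \<open>\<alpha> > 0\<close> its Laplacian, the sum over \<open>i\<close>
of the last line, is positive as soon as \<open>2 * \<alpha> * (norm (x - z))\<^sup>2\<close> exceeds
the dimension.\<close>
lemma has_pure_partials_gaussian:
  fixes z :: "real ^ 'n"
  shows "has_pure_partials (\<lambda>x. exp (- \<alpha> * (norm (x - z))\<^sup>2))
    (\<lambda>i x. - 2 * \<alpha> * (x - z) $ i * exp (- \<alpha> * (norm (x - z))\<^sup>2))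
    (\<lambda>i x. (4 * \<alpha>\<^sup>2 * ((x - z) $ i)\<^sup>2 - 2 * \<alpha>) * exp (- \<alpha> * (norm (x - z))\<^sup>2))"
proof -
  have *: "(norm (x + t *\<^sub>R axis i 1 - z))\<^sup>2 = (norm (x - z))\<^sup>2 + 2 * t * (x - z) $ i + t\<^sup>2" for x t i
  proof -
    have shift: "x + t *\<^sub>R axis i 1 - z = (x - z) + t *\<^sub>R axis i 1" by simp
    have "(norm (y + t *\<^sub>R axis i 1))\<^sup>2 = (norm y)\<^sup>2 + 2 * t * y $ i + t\<^sup>2" for y :: "real ^ 'n"
      unfolding power2_norm_eq_inner
      by (simp add: inner_add_left inner_add_right inner_axis inner_axis' power2_eq_square distrib_left)
    then show ?thesis
      unfolding shift .
  qed
  show ?thesis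
    unfolding has_pure_partials_def *
    by (auto intro!: derivative_eq_intros simp: algebra_simps power2_eq_square)
qed

text \<open>For orthonormal \<open>a\<close> and \<open>b\<close> this function has positive Laplacian
everywhere although it grows only logarithmically. So slow a growth takes two coordinates: a function of
one variable with positive second derivative grows at least linearly in one of the two
directions.\<close>
lemma has_pure_partials_log_barrier:
  fixes p a b :: "real ^ 'n"
  defines "q \<equiv> \<lambda>x. 1 + (a \<bullet> (x - p))\<^sup>2 + (b \<bullet> (x - p))\<^sup>2"
  shows "has_pure_partials (\<lambda>x. ln (q x))
    (\<lambda>i x. 2 * (a \<bullet> (x - p) * a $ i + b \<bullet> (x - p) * b $ i) / q x)
    (\<lambda>i x. 2 * ((a $ i)\<^sup>2 + (b $ i)\<^sup>2) / q x
         - 4 * (a \<bullet> (x - p) * a $ i + b \<bullet> (x - p) * b $ i)\<^sup>2 / (q x)\<^sup>2)"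
proof -
  have *: "c \<bullet> (x + t *\<^sub>R axis i 1 - p) = c \<bullet> (x - p) + t * c $ i" for x t i and c :: "real ^ 'n"
    by (simp add: inner_diff_right inner_add_right inner_axis algebra_simps)
  have pos: "1 + A\<^sup>2 + B\<^sup>2 > 0" for A B :: real
    by (simp add: add_pos_nonneg)
  have nz: "1 + A\<^sup>2 + B\<^sup>2 \<noteq> 0" for A B :: real
    using pos[of A B] by simp
  show ?thesis
    unfolding has_pure_partials_def q_def *
  proof (intro allI conjI)
    fix i and x :: "real ^ 'n"
    define A B where "A = a \<bullet> (x - p)" and "B = b \<bullet> (x - p)"
    show "((\<lambda>t. ln (1 + (a \<bullet> (x - p) + t * a $ i)\<^sup>2 + (b \<bullet> (x - p) + t * b $ i)\<^sup>2)) has_real_derivative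
         2 * (a \<bullet> (x - p) * a $ i + b \<bullet> (x - p) * b $ i) / (1 + (a \<bullet> (x - p))\<^sup>2 + (b \<bullet> (x - p))\<^sup>2)) (at 0)"
      unfolding A_def[symmetric] B_def[symmetric]
      using pos[of A B] by (auto intro!: derivative_eq_intros simp: field_simps)
    show "((\<lambda>t. 2 * ((a \<bullet> (x - p) + t * a $ i) * a $ i + (b \<bullet> (x - p) + t * b $ i) * b $ i) /
            (1 + (a \<bullet> (x - p) + t * a $ i)\<^sup>2 + (b \<bullet> (x - p) + t * b $ i)\<^sup>2)) has_real_derivative
         2 * ((a $ i)\<^sup>2 + (b $ i)\<^sup>2) / (1 + (a \<bullet> (x - p))\<^sup>2 + (b \<bullet> (x - p))\<^sup>2) -
         4 * (a \<bullet> (x - p) * a $ i + b \<bullet> (x - p) * b $ i)\<^sup>2 / (1 + (a \<bullet> (x - p))\<^sup>2 + (b \<bullet> (x - p))\<^sup>2)\<^sup>2) (at 0)"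
      unfolding A_def[symmetric] B_def[symmetric]
    proof -
      define Q where "Q = 1 + A\<^sup>2 + B\<^sup>2"
      have "Q \<noteq> 0" using nz by (simp add: Q_def)
      define N where "N = A * a $ i + B * b $ i"
      have "((\<lambda>t. 2 * ((A + t * a $ i) * a $ i + (B + t * b $ i) * b $ i) /
            (1 + (A + t * a $ i)\<^sup>2 + (B + t * b $ i)\<^sup>2)) has_real_derivative
         (2 * ((a $ i)\<^sup>2 + (b $ i)\<^sup>2) * Q - 2 * N * (2 * N)) / (Q * Q)) (at 0)"
        using nz[of A B] unfolding Q_def N_def
        by (auto intro!: derivative_eq_intros simp: algebra_simps power2_eq_square)
      moreover have "(2 * ((a $ i)\<^sup>2 + (b $ i)\<^sup>2) * Q - 2 * N * (2 * N)) / (Q * Q)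
          = 2 * ((a $ i)\<^sup>2 + (b $ i)\<^sup>2) / Q - 4 * N\<^sup>2 / Q\<^sup>2"
        using \<open>Q \<noteq> 0\<close> by (simp add: field_simps power2_eq_square)
      ultimately show "((\<lambda>t. 2 * ((A + t * a $ i) * a $ i + (B + t * b $ i) * b $ i) /
            (1 + (A + t * a $ i)\<^sup>2 + (B + t * b $ i)\<^sup>2)) has_real_derivative
         2 * ((a $ i)\<^sup>2 + (b $ i)\<^sup>2) / (1 + A\<^sup>2 + B\<^sup>2) -
         4 * (A * a $ i + B * b $ i)\<^sup>2 / (1 + A\<^sup>2 + B\<^sup>2)\<^sup>2) (at 0)"
        by (simp add: Q_def N_def)
    qed
  qed
qed

text \<open>The Laplacian of the logarithmic barrier is that of \<open>ln (1 + r\<^sup>2)\<close> in the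
plane. Here \<open>A\<close> and \<open>B\<close> stand for \<open>a \<bullet> (x - p)\<close> and
\<open>b \<bullet> (x - p)\<close>.\<close>
lemma log_barrier_laplacian:
  fixes a b :: "real ^ 'n" and A B :: real
  assumes "norm a = 1" "norm b = 1" "a \<bullet> b = 0"
  shows "(\<Sum>i\<in>UNIV. 2 * ((a $ i)\<^sup>2 + (b $ i)\<^sup>2) / (1 + A\<^sup>2 + B\<^sup>2)
           - 4 * (A * a $ i + B * b $ i)\<^sup>2 / (1 + A\<^sup>2 + B\<^sup>2)\<^sup>2) = 4 / (1 + A\<^sup>2 + B\<^sup>2)\<^sup>2"
proof -
  have aa: "(\<Sum>i\<in>UNIV. (a $ i)\<^sup>2) = 1" and bb: "(\<Sum>i\<in>UNIV. (b $ i)\<^sup>2) = 1"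
    and ab: "(\<Sum>i\<in>UNIV. a $ i * b $ i) = 0"
    using assms by (simp_all add: norm_eq_1 inner_vec_def power2_eq_square)
  have "(\<Sum>i\<in>UNIV. (A * a $ i + B * b $ i)\<^sup>2)
      = (\<Sum>i\<in>UNIV. A\<^sup>2 * (a $ i)\<^sup>2 + 2 * A * B * (a $ i * b $ i) + B\<^sup>2 * (b $ i)\<^sup>2)"
    by (rule sum.cong) (auto simp: power2_eq_square algebra_simps)
  also have "\<dots> = A\<^sup>2 + B\<^sup>2"
    unfolding sum.distrib sum_distrib_left[symmetric] aa bb ab by simp
  finally have sq: "(\<Sum>i\<in>UNIV. (A * a $ i + B * b $ i)\<^sup>2) = A\<^sup>2 + B\<^sup>2" .
  have "1 + A\<^sup>2 + B\<^sup>2 > 0"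
    by (simp add: add_pos_nonneg)
  then have "4 / (1 + A\<^sup>2 + B\<^sup>2) - 4 * (A\<^sup>2 + B\<^sup>2) / (1 + A\<^sup>2 + B\<^sup>2)\<^sup>2 = 4 / (1 + A\<^sup>2 + B\<^sup>2)\<^sup>2"
    by (simp add: divide_simps) (simp add: algebra_simps power2_eq_square)
  then show ?thesis
    unfolding sum_subtractf sum_divide_distrib[symmetric] sum_distrib_left[symmetric]
      sum.distrib aa bb sq by simp
qed

section \<open>The strong minimum principle\<close>

text \<open>Hopf's argument. Around a point \<open>z\<close> with \<open>w z > 0\<close> take the
largest open ball free of zeros; its boundary meets a zero \<open>p\<close>. On the annulus between half
the radius and the full radius, a small multiple of the Gaussian barrier, lowered so that it vanishes on
the outer sphere, lies below \<open>w\<close>, and it rises from \<open>p\<close> inwards with positive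
slope, whereas \<open>w\<close> has slope \<open>0\<close> at its minimum \<open>p\<close>.\<close>
lemma strong_minimum_principle:
  fixes w :: "real ^ 'n \<Rightarrow> real"
  assumes w: "has_pure_partials w g h"
    and diff: "\<And>x. w differentiable (at x)"
    and superharmonic: "\<And>x. (\<Sum>i\<in>UNIV. h i x) \<le> 0"
    and nonneg: "\<And>x. w x \<ge> 0"
    and zero: "w x0 = 0"
  shows "w x = 0"
proof (rule ccontr)
  assume nz: "w x \<noteq> 0"
  define z where "z = x"
  have cont: "continuous_on S w" for S
    using diff by (simp add: continuous_at_imp_continuous_on differentiable_imp_continuous_within)
  define Z where "Z = {y. w y = 0}"
  have "closed Z"
    using continuous_closed_vimage[of "{0}" w] cont[of UNIV]
    by (simp add: Z_def vimage_def continuous_on_eq_continuous_at)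
  moreover have "Z \<noteq> {}"
    using zero by (auto simp: Z_def)
  ultimately obtain p where p: "p \<in> Z" "\<And>y. y \<in> Z \<Longrightarrow> dist z p \<le> dist z y"
    using distance_attains_inf[of Z z] by metis
  define \<rho> where "\<rho> = dist z p"
  have "z \<noteq> p"
    using p(1) nz by (auto simp: Z_def z_def)
  then have \<rho>: "\<rho> > 0" by (simp add: \<rho>_def)
  have pos: "w y > 0" if "dist z y < \<rho>" for y
    using p(2)[of y] that nonneg[of y] by (cases "w y = 0") (auto simp: Z_def \<rho>_def)
  define A where "A = cball z \<rho> - ball z (\<rho> / 2)"
  have "compact (sphere z (\<rho> / 2))" by simp
  moreover have "sphere z (\<rho> / 2) \<noteq> {}"
    using \<rho> by (simp add: sphere_eq_empty)
  ultimately obtain y0 where y0: "y0 \<in> sphere z (\<rho> / 2)" "\<And>y. y \<in> sphere z (\<rho> / 2) \<Longrightarrow> w y0 \<le> w y"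
    using continuous_attains_inf[OF _ _ cont] by metis
  have "w y0 > 0"
    using y0(1) \<rho> by (intro pos) auto
  define \<epsilon> where "\<epsilon> = w y0"
  \<comment> \<open>large enough for the Gaussian to be strictly subharmonic at distance at least \<open>\<rho> / 2\<close>\<close>
  define \<alpha> where "\<alpha> = 2 * CARD('n) / \<rho>\<^sup>2 + 1 / \<rho>\<^sup>2"
  have \<alpha>: "\<alpha> > 0" "2 * real CARD('n) < \<alpha> * \<rho>\<^sup>2"
    using \<rho> by (simp_all add: \<alpha>_def field_simps add_nonneg_pos)
  define E where "E y = exp (- \<alpha> * (norm (y - z))\<^sup>2)" for y
  define E\<^sub>\<rho> where "E\<^sub>\<rho> = exp (- \<alpha> * \<rho>\<^sup>2)"
  have "E\<^sub>\<rho> > 0" by (simp add: E\<^sub>\<rho>_def)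
  define F where "F y = w y - \<epsilon> * (E y - E\<^sub>\<rho>)" for y
  have contF: "continuous_on S F" for S
    unfolding F_def E_def by (intro continuous_intros cont)
  have E1: "E y \<le> 1" for y
    using \<alpha> by (simp add: E_def)
  have above: "F y \<ge> 0" if yA: "y \<in> A" for y
  proof (rule ccontr)
    assume neg: "\<not> F y \<ge> 0"
    have "compact A"
      by (simp add: A_def compact_diff)
    then obtain q where q: "q \<in> A" "\<And>y. y \<in> A \<Longrightarrow> F q \<le> F y"
      using continuous_attains_inf[OF _ _ contF, of A] yA by blast
    \<comment> \<open>a negative minimum lies on neither boundary sphere: on the outer one the barrier vanishes,
      on the inner one it is at most \<open>\<epsilon>\<close>\<close>
    have Fq: "F q < 0"
      using q(2)[OF yA] neg by simp
    have "dist z q \<noteq> \<rho>"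
    proof
      assume "dist z q = \<rho>"
      then have "E q = E\<^sub>\<rho>" by (simp add: E_def E\<^sub>\<rho>_def dist_norm norm_minus_commute)
      then show False using Fq nonneg[of q] by (simp add: F_def)
    qed
    moreover have "dist z q \<noteq> \<rho> / 2"
    proof
      assume "dist z q = \<rho> / 2"
      then have "w q \<ge> \<epsilon>" using y0(2)[of q] by (simp add: \<epsilon>_def)
      moreover have "\<epsilon> * (E q - E\<^sub>\<rho>) \<le> \<epsilon> * 1"
        using E1[of q] \<open>w y0 > 0\<close> \<open>E\<^sub>\<rho> > 0\<close> by (intro mult_left_mono) (auto simp: \<epsilon>_def)
      ultimately show False using Fq by (simp add: F_def)
    qed
    ultimately have q_in: "q \<in> ball z \<rho> - cball z (\<rho> / 2)"
      using q(1) by (auto simp: A_def)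
    have "open (ball z \<rho> - cball z (\<rho> / 2))"
      by (simp add: open_Diff)
    then have "eventually (\<lambda>y. y \<in> ball z \<rho> - cball z (\<rho> / 2)) (nhds q)"
      using q_in by (rule eventually_nhds_in_open)
    then have locmax: "eventually (\<lambda>y. - w y + \<epsilon> * E y \<le> - w q + \<epsilon> * E q) (nhds q)"
    proof (rule eventually_mono)
      fix y assume "y \<in> ball z \<rho> - cball z (\<rho> / 2)"
      then have "F q \<le> F y" by (intro q(2)) (auto simp: A_def)
      then show "- w y + \<epsilon> * E y \<le> - w q + \<epsilon> * E q"
        by (simp add: F_def algebra_simps)
    qed
    from has_pure_partials_add_scaled[OF has_pure_partials_minus[OF w] has_pure_partials_gaussian[of \<alpha> z], of \<epsilon>, folded E_def]
    have "(\<Sum>i\<in>UNIV. - h i q + \<epsilon> * ((4 * \<alpha>\<^sup>2 * ((q - z) $ i)\<^sup>2 - 2 * \<alpha>) * E q)) \<le> 0"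
      by (rule sum_pure_partials_nonpos_at_max) (rule locmax)
    moreover have "(\<Sum>i\<in>UNIV. - h i q + \<epsilon> * ((4 * \<alpha>\<^sup>2 * ((q - z) $ i)\<^sup>2 - 2 * \<alpha>) * E q))
        = - (\<Sum>i\<in>UNIV. h i q) + \<epsilon> * E q * (4 * \<alpha>\<^sup>2 * (norm (q - z))\<^sup>2 - 2 * \<alpha> * CARD('n))"
      unfolding norm_vec_def L2_set_def
      by (simp add: sum.distrib sum_negf sum_subtractf sum_distrib_left[symmetric] sum_distrib_right[symmetric]
          sum_nonneg algebra_simps)
    moreover have "\<epsilon> * E q * (4 * \<alpha>\<^sup>2 * (norm (q - z))\<^sup>2 - 2 * \<alpha> * CARD('n)) > 0"
    proof -
      have "\<rho> / 2 \<le> norm (q - z)"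
        using q_in by (auto simp: dist_norm norm_minus_commute)
      then have "(\<rho> / 2)\<^sup>2 \<le> (norm (q - z))\<^sup>2"
        using \<rho> by (intro power_mono) auto
      then have "\<alpha> * (\<alpha> * \<rho>\<^sup>2) \<le> 4 * \<alpha>\<^sup>2 * (norm (q - z))\<^sup>2"
        using \<alpha> by (simp add: power2_eq_square field_simps)
      moreover have "\<alpha> * (2 * real CARD('n)) < \<alpha> * (\<alpha> * \<rho>\<^sup>2)"
        using \<alpha> by (intro mult_strict_left_mono)
      ultimately show ?thesis
        using \<open>w y0 > 0\<close> by (intro mult_pos_pos) (auto simp: \<epsilon>_def E_def algebra_simps)
    qed
    ultimately show False
      using superharmonic[of q] by linarith
  qed
  \<comment> \<open>\<open>F\<close> vanishes at the touching point \<open>p\<close> and \<open>w\<close> is critical there, so along the radius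
    from \<open>p\<close> to \<open>z\<close> the slope of \<open>F\<close> is that of \<open>- \<epsilon> * E\<close>, which is negative:
    \<open>F\<close> becomes negative inside the annulus.\<close>
  have wp: "w p = 0" using p(1) by (simp add: Z_def)
  have "(w has_derivative (\<lambda>_. 0)) (at p)"
  proof -
    have "(w has_derivative frechet_derivative w (at p)) (at p)"
      using diff frechet_derivative_works by blast
    then show ?thesis
      using has_derivative_local_min[of w _ p] nonneg wp by fastforce
  qed
  moreover have "((\<lambda>s::real. p + s *\<^sub>R (z - p)) has_derivative (\<lambda>s. s *\<^sub>R (z - p))) (at 0)"
    by (auto intro!: derivative_eq_intros)
  ultimately have "((\<lambda>s. w (p + s *\<^sub>R (z - p))) has_derivative (\<lambda>s. 0)) (at 0)"
    using has_derivative_compose[of "\<lambda>s::real. p + s *\<^sub>R (z - p)" _ 0 UNIV w "\<lambda>_. 0"] by simp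
  then have dw: "((\<lambda>s. w (p + s *\<^sub>R (z - p))) has_real_derivative 0) (at 0)"
    by (simp add: has_field_derivative_def lambda_zero)
  have Es: "E (p + s *\<^sub>R (z - p)) = exp (- \<alpha> * ((1 - s)\<^sup>2 * \<rho>\<^sup>2))" for s
  proof -
    have "p + s *\<^sub>R (z - p) - z = (1 - s) *\<^sub>R (p - z)" by (simp add: algebra_simps)
    then show ?thesis
      by (simp add: E_def power_mult_distrib \<rho>_def dist_norm norm_minus_commute)
  qed
  have "((\<lambda>s. F (p + s *\<^sub>R (z - p))) has_real_derivative - (\<epsilon> * (2 * \<alpha> * \<rho>\<^sup>2 * E\<^sub>\<rho>))) (at 0)"
    unfolding F_def Es E\<^sub>\<rho>_def
    by (rule derivative_eq_intros dw refl | simp)+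
  moreover have "- (\<epsilon> * (2 * \<alpha> * \<rho>\<^sup>2 * E\<^sub>\<rho>)) < 0"
    using \<open>w y0 > 0\<close> \<alpha> \<rho> by (simp add: \<epsilon>_def E\<^sub>\<rho>_def)
  ultimately have "\<exists>d>0. \<forall>s>0. s < d \<longrightarrow> F (p + (0 + s) *\<^sub>R (z - p)) < F (p + 0 *\<^sub>R (z - p))"
    by (rule DERIV_neg_dec_right)
  then obtain d where d: "d > 0" "\<And>s. 0 < s \<Longrightarrow> s < d \<Longrightarrow> F (p + s *\<^sub>R (z - p)) < F p"
    by auto
  have "F p = 0"
    using Es[of 0] wp by (simp add: F_def E\<^sub>\<rho>_def)
  define s where "s = min d 1 / 2"
  have s: "0 < s" "s < d" "s \<le> 1 / 2"
    using d(1) by (auto simp: s_def)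
  have dist_eq: "dist z (p + s *\<^sub>R (z - p)) = (1 - s) * \<rho>"
  proof -
    have "z - (p + s *\<^sub>R (z - p)) = (1 - s) *\<^sub>R (z - p)" by (simp add: algebra_simps)
    then show ?thesis using s by (simp add: dist_norm \<rho>_def)
  qed
  have "(1 - s) * \<rho> \<le> 1 * \<rho>" "1 / 2 * \<rho> \<le> (1 - s) * \<rho>"
    using s \<rho> by (intro mult_right_mono; simp)+
  then have "p + s *\<^sub>R (z - p) \<in> A"
    using dist_eq by (simp add: A_def)
  then show False
    using above d(2)[OF s(1,2)] \<open>F p = 0\<close> by fastforce
qed

section \<open>The ordinary differential equation of the profile\<close>

text \<open>The equation \<open>y'' = l\<^sup>2 y\<close> factors into first-order equations, each of
which has an integrating factor.\<close>
lemma linear_second_order_unique: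
  fixes y y' :: "real \<Rightarrow> real"
  assumes y: "\<And>t. (y has_real_derivative y' t) (at t)"
    and y': "\<And>t. (y' has_real_derivative l\<^sup>2 * y t) (at t)"
    and init: "y t0 = 0" "y' t0 = 0"
  shows "y t = 0"
proof -
  have "((\<lambda>t. exp (- l * t) * (y' t + l * y t)) has_real_derivative 0) (at t)" for t
    by (rule derivative_eq_intros y y' refl | simp add: algebra_simps power2_eq_square)+
  then have 1: "exp (- l * t) * (y' t + l * y t) = exp (- l * t0) * (y' t0 + l * y t0)" for t
    using DERIV_isconst_all by blast
  then have y'_eq: "y' t = - l * y t" for t
    using init by (simp add: add_eq_0_iff2)
  have "((\<lambda>t. exp (l * t) * y t) has_real_derivative 0) (at t)" for t
    by (rule derivative_eq_intros y refl | simp add: y'_eq)+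
  then have "exp (l * t) * y t = exp (l * t0) * y t0"
    using DERIV_isconst_all by blast
  then show ?thesis
    using init by simp
qed

text \<open>The energy \<open>f'\<^sup>2 + exp (2 f)\<close> is constant, with value
\<open>l\<^sup>2\<close> for \<open>l = exp (f t0)\<close>. Hence \<open>exp (- f)\<close> satisfies the
linear equation \<open>y'' = (f'\<^sup>2 + exp (2 f)) y = l\<^sup>2 y\<close>, and its initial data at
the critical point \<open>t0\<close> are those of \<open>cosh (l (t - t0)) / l\<close>.\<close>
lemma ode_with_critical_point:
  fixes f f' :: "real \<Rightarrow> real"
  assumes f: "\<And>t. (f has_real_derivative f' t) (at t)"
    and f': "\<And>t. (f' has_real_derivative - exp (2 * f t)) (at t)"
    and crit: "f' t0 = 0"
  shows "f t = f t0 + ln (sech (exp (f t0) * (t - t0)))"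
proof -
  define l where "l = exp (f t0)"
  have "((\<lambda>t. (f' t)\<^sup>2 + exp (2 * f t)) has_real_derivative 0) (at t)" for t
    by (rule derivative_eq_intros f f' refl | simp add: algebra_simps power2_eq_square)+
  then have "(f' t)\<^sup>2 + exp (2 * f t) = (f' t0)\<^sup>2 + exp (2 * f t0)" for t
    using DERIV_isconst_all by blast
  then have energy: "(f' t)\<^sup>2 + exp (2 * f t) = l\<^sup>2" for t
    using crit by (simp add: l_def exp_double)
  define y where "y t = exp (- f t) - cosh (l * (t - t0)) / l" for t
  define y' where "y' t = - f' t * exp (- f t) - sinh (l * (t - t0))" for t
  have "l > 0" by (simp add: l_def)
  have "(y has_real_derivative y' t) (at t)" for t
    unfolding y_def y'_def
    using \<open>l > 0\<close> by (auto intro!: derivative_eq_intros f)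
  moreover have "(y' has_real_derivative l\<^sup>2 * y t) (at t)" for t
  proof -
    have "(y' has_real_derivative (exp (2 * f t) + (f' t)\<^sup>2) * exp (- f t) - l * cosh (l * (t - t0))) (at t)"
      unfolding y'_def
      by (rule derivative_eq_intros f f' refl | simp add: algebra_simps power2_eq_square)+
    moreover have "(exp (2 * f t) + (f' t)\<^sup>2) * exp (- f t) - l * cosh (l * (t - t0)) = l\<^sup>2 * y t"
      using energy[of t] \<open>l > 0\<close> by (simp add: y_def field_simps power2_eq_square add.commute)
    ultimately show ?thesis by simp
  qed
  moreover have "y t0 = 0" "y' t0 = 0"
    using crit by (simp_all add: y_def y'_def l_def exp_minus field_simps)
  ultimately have "y t = 0"
    by (rule linear_second_order_unique)
  then have "exp (- f t) = cosh (l * (t - t0)) / l"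
    by (simp add: y_def)
  then have "exp (f t) = l * sech (l * (t - t0))"
    by (simp add: sech_def exp_minus field_simps)
  then have "f t = ln (l * sech (l * (t - t0)))"
    by (metis ln_exp)
  also have "\<dots> = f t0 + ln (sech (l * (t - t0)))"
    using \<open>l > 0\<close> by (subst ln_mult) (auto simp: l_def sech_def)
  finally show ?thesis
    by (simp add: l_def)
qed

section \<open>Concave functions with a maximum\<close>

text \<open>The point \<open>x + e\<close> is the limit, as \<open>s\<close> tends to \<open>0\<close>,
of points dividing the segment from \<open>x\<close> to the far point \<open>x0 + e / s\<close> in the
ratio \<open>s\<close>. Since \<open>u\<close> is maximal at the far end, concavity gives at least
\<open>u x\<close> at each of these points.\<close>
lemma concave_nondecreasing_along_ray_of_maxima:
  fixes u :: "'a::real_normed_vector \<Rightarrow> real"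
  assumes conc: "concave_on UNIV u"
    and cont: "continuous_on UNIV u"
    and max: "\<And>y. u y \<le> u x0"
    and ray: "\<And>t. t \<ge> 0 \<Longrightarrow> u (x0 + t *\<^sub>R e) = u x0"
  shows "u x \<le> u (x + e)"
proof -
  have bound: "u x \<le> u (x + e + inverse (real (Suc n)) *\<^sub>R (x0 - x))" for n
  proof -
    define s where "s = inverse (real (Suc n))"
    have s: "0 < s" "s \<le> 1"
      by (auto simp: s_def field_simps)
    have conc_ineq: "(1 - s) * u x + s * u (x0 + inverse s *\<^sub>R e) \<le> u ((1 - s) *\<^sub>R x + s *\<^sub>R (x0 + inverse s *\<^sub>R e))"
      using conc s by (simp add: concave_on_iff)
    have eq: "(1 - s) *\<^sub>R x + s *\<^sub>R (x0 + inverse s *\<^sub>R e) = x + e + s *\<^sub>R (x0 - x)"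
      using s by (simp add: algebra_simps)
    have "s * u x \<le> s * u (x0 + inverse s *\<^sub>R e)"
      using s ray[of "inverse s"] max by (intro mult_left_mono) auto
    then show ?thesis
      using conc_ineq[unfolded eq left_diff_distrib] unfolding s_def[symmetric] by linarith
  qed
  have "(\<lambda>n. x + e + inverse (real (Suc n)) *\<^sub>R (x0 - x)) \<longlonglongrightarrow> x + e + 0 *\<^sub>R (x0 - x)"
    by (intro tendsto_intros LIMSEQ_inverse_real_of_nat)
  moreover have "isCont u (x + e)"
    using cont by (simp add: continuous_on_eq_continuous_at)
  ultimately have "(\<lambda>n. u (x + e + inverse (real (Suc n)) *\<^sub>R (x0 - x))) \<longlonglongrightarrow> u (x + e)"
    using isCont_tendsto_compose[of "x + e" u] by simp
  then show ?thesis
    using bound LIMSEQ_le_const by blast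
qed

text \<open>If some sphere about \<open>x0\<close> in \<open>x0 + V\<close> avoids the set of maxima,
then compactness gives a uniform drop on that sphere and concavity extends it to linear decay. Otherwise
the directions in \<open>V\<close> that reach a maximum at distance \<open>n\<close> form a decreasing
sequence of nonempty compact sets, and a direction common to all of them spans a ray of maxima.\<close>
lemma concave_linear_decay:
  fixes u :: "'a::euclidean_space \<Rightarrow> real"
  assumes conc: "concave_on UNIV u"
    and cont: "continuous_on UNIV u"
    and max: "\<And>y. u y \<le> u x0"
    and V: "subspace V"
    and no_ray: "\<And>e. e \<in> V \<Longrightarrow> norm e = 1 \<Longrightarrow> \<exists>t\<ge>0. u (x0 + t *\<^sub>R e) \<noteq> u x0"
  obtains c C where "c > 0" "\<And>y. y \<in> V \<Longrightarrow> u (x0 + y) \<le> C - c * norm y"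
proof -
  have chord: "(1 - s) * u x0 + s * u (x0 + y) \<le> u (x0 + s *\<^sub>R y)" if "0 \<le> s" "s \<le> 1" for s y
  proof -
    have "(1 - s) * u x0 + s * u (x0 + y) \<le> u ((1 - s) *\<^sub>R x0 + s *\<^sub>R (x0 + y))"
      using conc that by (simp add: concave_on_iff)
    then show ?thesis by (simp add: algebra_simps)
  qed
  define S where "S = V \<inter> sphere 0 1"
  have S: "compact S"
    using closed_subspace[OF V] by (simp add: S_def closed_Int_compact)
  \<comment> \<open>the radius is \<open>Suc n\<close> so that it is positive\<close>
  define T where "T n = {e \<in> S. u x0 \<le> u (x0 + real (Suc n) *\<^sub>R e)}" for n
  have far_max: "u (x0 + t *\<^sub>R e) = u x0" if "u x0 \<le> u (x0 + r *\<^sub>R e)" "0 \<le> t" "t \<le> r" "r > 0" for t r e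
  proof -
    have "(1 - t / r) * u x0 + (t / r) * u x0 \<le> (1 - t / r) * u x0 + (t / r) * u (x0 + r *\<^sub>R e)"
      using that by (intro add_left_mono mult_left_mono) auto
    also have "\<dots> \<le> u (x0 + t *\<^sub>R e)"
      using chord[of "t / r" "r *\<^sub>R e"] that by simp
    finally show ?thesis
      using max[of "x0 + t *\<^sub>R e"] by (simp add: algebra_simps)
  qed
  have contS: "continuous_on A (\<lambda>e. u (x0 + r *\<^sub>R e))" for r A
    by (intro continuous_on_compose2[OF cont] continuous_intros) auto
  have "\<exists>n. T n = {}"
  proof (rule ccontr)
    assume "\<nexists>n. T n = {}"
    moreover have "compact (T n)" for n
    proof -
      have "closed {e. u x0 \<le> u (x0 + real (Suc n) *\<^sub>R e)}"
        using contS[of UNIV] by (intro closed_Collect_le continuous_intros)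
      moreover have "T n = S \<inter> {e. u x0 \<le> u (x0 + real (Suc n) *\<^sub>R e)}"
        by (auto simp: T_def)
      ultimately show ?thesis
        using S by (simp add: compact_Int_closed)
    qed
    moreover have "T n \<subseteq> T m" if "m \<le> n" for m n
      using far_max[of "real (Suc n)" _ "real (Suc m)"] that by (auto simp: T_def)
    ultimately have "\<Inter>(range T) \<noteq> {}"
      by (intro compact_nest) auto
    then obtain e where e: "\<And>n. e \<in> T n"
      by auto
    have "u (x0 + t *\<^sub>R e) = u x0" if "t \<ge> 0" for t
    proof -
      obtain n where "t \<le> real n" using real_arch_simple by blast
      then show ?thesis
        using e[of n] that by (intro far_max[of "real (Suc n)"]) (auto simp: T_def)
    qed
    moreover have "e \<in> V" "norm e = 1"
      using e[of 0] by (auto simp: T_def S_def)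
    ultimately show False
      using no_ray by blast
  qed
  then obtain n where n: "T n = {}" ..
  define R where "R = real (Suc n)"
  have R: "R > 0" by (simp add: R_def)
  have below: "u (x0 + R *\<^sub>R e) < u x0" if "e \<in> S" for e
    using n that by (auto simp: T_def R_def)
  obtain \<delta> where \<delta>: "\<delta> > 0" "\<And>e. e \<in> S \<Longrightarrow> u (x0 + R *\<^sub>R e) \<le> u x0 - \<delta>"
  proof (cases "S = {}")
    case True
    then show ?thesis using that[of 1] by simp
  next
    case False
    then obtain e0 where "e0 \<in> S" "\<And>e. e \<in> S \<Longrightarrow> u (x0 + R *\<^sub>R e) \<le> u (x0 + R *\<^sub>R e0)"
      using continuous_attains_sup[OF S _ contS] by blast
    then show ?thesis
      using that[of "u x0 - u (x0 + R *\<^sub>R e0)"] below[of e0] by auto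
  qed
  have "u (x0 + y) \<le> (u x0 + \<delta>) - \<delta> / R * norm y" if "y \<in> V" for y
  proof (cases "norm y \<le> R")
    case True
    then have "\<delta> / R * norm y \<le> \<delta>"
      using R \<delta>(1) by (simp add: field_simps)
    then show ?thesis
      using max[of "x0 + y"] by simp
  next
    case False
    then have y: "norm y > R" "norm y > 0" using R by auto
    define e where "e = (1 / norm y) *\<^sub>R y"
    have "e \<in> S"
      using y that V by (auto simp: S_def e_def subspace_scale)
    define s where "s = R / norm y"
    have s: "0 < s" "s \<le> 1" using y R by (auto simp: s_def)
    have "R *\<^sub>R e = s *\<^sub>R y" by (simp add: e_def s_def)
    then have "(1 - s) * u x0 + s * u (x0 + y) \<le> u x0 - \<delta>"
      using chord[of s y] \<delta>(2)[OF \<open>e \<in> S\<close>] s by simp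
    then have "s * u (x0 + y) \<le> s * (u x0 - \<delta> / s)"
      using s by (simp add: algebra_simps)
    then have "u (x0 + y) \<le> u x0 - \<delta> / s"
      using s by (simp add: mult_le_cancel_left)
    then show ?thesis
      using \<delta>(1) by (simp add: s_def)
  qed
  then show thesis
    using that[of "\<delta> / R" "u x0 + \<delta>"] \<delta>(1) R by simp
qed

section \<open>Linear decay in two directions is impossible\<close>

lemma bessel_two:
  fixes a b y :: "'a::real_inner"
  assumes "norm a = 1" "norm b = 1" "a \<bullet> b = 0"
  shows "(a \<bullet> y)\<^sup>2 + (b \<bullet> y)\<^sup>2 \<le> (norm y)\<^sup>2"
proof -
  define z where "z = y - (a \<bullet> y) *\<^sub>R a - (b \<bullet> y) *\<^sub>R b"
  have "0 \<le> z \<bullet> z" by simp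
  also have "z \<bullet> z = y \<bullet> y - (a \<bullet> y)\<^sup>2 - (b \<bullet> y)\<^sup>2"
    using assms unfolding z_def norm_eq_1
    by (simp add: inner_diff_left inner_diff_right inner_commute power2_eq_square algebra_simps)
  finally show ?thesis
    by (simp add: power2_norm_eq_inner)
qed

text \<open>Linear decay of \<open>u\<close> makes \<open>exp (2 u)\<close> exponentially small, hence
smaller than the Laplacian \<open>4 k / (1 + r\<^sup>2)\<^sup>2\<close> of \<open>k ln (1 +
r\<^sup>2)\<close> for large \<open>k\<close>. So \<open>G = u + k ln (1 + r\<^sup>2)\<close> has
positive Laplacian; yet it tends to minus infinity on \<open>x0 + V\<close>, because the logarithm
cannot compensate the linear decay, and therefore it has a maximum. The hypothesis \<open>split\<close>
says that \<open>u\<close> and the linear forms from \<open>V\<close> only see the component in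
\<open>V\<close>, which makes this a maximum over the whole space.\<close>
lemma no_linear_decay_in_two_directions:
  fixes u :: "real ^ 'n \<Rightarrow> real"
  assumes u: "has_pure_partials u g h"
    and eq: "\<And>x. (\<Sum>i\<in>UNIV. h i x) = - exp (2 * u x)"
    and cont: "continuous_on UNIV u"
    and V: "subspace V"
    and split: "\<And>x. \<exists>y\<in>V. (\<forall>v\<in>V. v \<bullet> (x - x0) = v \<bullet> y) \<and> u x = u (x0 + y)"
    and decay: "c > 0" "\<And>y. y \<in> V \<Longrightarrow> u (x0 + y) \<le> C - c * norm y"
    and ab: "a \<in> V" "b \<in> V" "norm a = 1" "norm b = 1" "a \<bullet> b = 0"
  shows False
proof -
  \<comment> \<open>\<open>\<kappa> * (1 + s\<^sup>2) \<le> exp (c * s)\<close> by the quadratic Taylor bound; \<open>k\<close> is then chosen so that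
    \<open>exp (2 * u) \<le> k / (1 + r\<^sup>2)\<^sup>2\<close>, short of the barrier's Laplacian by a factor \<open>4\<close>\<close>
  define \<kappa> where "\<kappa> = min 1 (c\<^sup>2 / 2)"
  have \<kappa>: "\<kappa> > 0" using decay(1) by (simp add: \<kappa>_def)
  have \<kappa>_le: "\<kappa> \<le> 1" "\<kappa> \<le> c\<^sup>2 / 2" by (simp_all add: \<kappa>_def)
  define k where "k = exp (2 * C) / \<kappa>\<^sup>2"
  have k: "k > 0" using \<kappa> by (simp add: k_def)
  define q where "q x = 1 + (a \<bullet> (x - x0))\<^sup>2 + (b \<bullet> (x - x0))\<^sup>2" for x
  define G where "G x = u x + k * ln (q x)" for x
  have q1: "q x \<ge> 1" for x by (simp add: q_def)
  have q_le: "q (x0 + y) \<le> 1 + (norm y)\<^sup>2" for y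
    using bessel_two[OF ab(3-5), of y] by (simp add: q_def)
  have G_le: "G (x0 + y) \<le> C - c * norm y + k * ln (1 + (norm y)\<^sup>2)" if "y \<in> V" for y
  proof -
    have "ln (q (x0 + y)) \<le> ln (1 + (norm y)\<^sup>2)"
      using q_le[of y] q1[of "x0 + y"] by (subst ln_le_cancel_iff) auto
    then show ?thesis
      using decay(2)[OF that] k unfolding G_def by (intro add_mono mult_left_mono) auto
  qed
  have "filterlim (\<lambda>s::real. C - c * s + k * ln (1 + s\<^sup>2)) at_bot at_top"
    using decay(1) k by real_asymp
  then have "eventually (\<lambda>s::real. C - c * s + k * ln (1 + s\<^sup>2) \<le> u x0) at_top"
    by (simp add: filterlim_at_bot)
  then obtain R where R: "\<And>s. s \<ge> R \<Longrightarrow> C - c * s + k * ln (1 + s\<^sup>2) \<le> u x0"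
    by (auto simp: eventually_at_top_linorder)
  define S where "S = V \<inter> cball 0 \<bar>R\<bar>"
  have "compact S"
    using closed_subspace[OF V] by (simp add: S_def closed_Int_compact)
  moreover have "0 \<in> S"
    using V by (simp add: S_def subspace_0)
  moreover have "continuous_on S (\<lambda>y. G (x0 + y))"
  proof -
    have "continuous_on UNIV G"
      unfolding G_def q_def
      by (intro continuous_intros cont) (smt (verit) zero_le_power2)
    then show ?thesis
      by (rule continuous_on_compose2) (auto intro!: continuous_intros)
  qed
  ultimately obtain y0 where y0: "y0 \<in> S" "\<And>y. y \<in> S \<Longrightarrow> G (x0 + y) \<le> G (x0 + y0)"
    using continuous_attains_sup[of S "\<lambda>y. G (x0 + y)"] by blast
  have "G x \<le> G (x0 + y0)" for x
  proof -
    obtain y where y: "y \<in> V" "\<forall>v\<in>V. v \<bullet> (x - x0) = v \<bullet> y" "u x = u (x0 + y)"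
      using split by blast
    have "G x = G (x0 + y)"
      using y ab by (simp add: G_def q_def)
    also have "\<dots> \<le> G (x0 + y0)"
    proof (cases "norm y \<le> \<bar>R\<bar>")
      case True
      then show ?thesis using y0(2) y(1) by (simp add: S_def)
    next
      case False
      then have "G (x0 + y) \<le> u x0"
        using G_le[OF y(1)] R[of "norm y"] by linarith
      also have "u x0 = G (x0 + 0)"
        by (simp add: G_def q_def)
      also have "\<dots> \<le> G (x0 + y0)"
        using y0(2) \<open>0 \<in> S\<close> by blast
      finally show ?thesis .
    qed
    finally show ?thesis .
  qed
  then have G_max: "eventually (\<lambda>x. G x \<le> G (x0 + y0)) (nhds (x0 + y0))"
    by simp
  define A B where "A = a \<bullet> y0" and "B = b \<bullet> y0"
  have "(\<Sum>i\<in>UNIV. h i (x0 + y0) + k * (2 * ((a $ i)\<^sup>2 + (b $ i)\<^sup>2) / (1 + A\<^sup>2 + B\<^sup>2)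
           - 4 * (A * a $ i + B * b $ i)\<^sup>2 / (1 + A\<^sup>2 + B\<^sup>2)\<^sup>2)) \<le> 0"
    using sum_pure_partials_nonpos_at_max[OF has_pure_partials_add_scaled[OF u has_pure_partials_log_barrier[of a x0 b], of k]
      G_max[unfolded G_def q_def]]
    by (simp add: A_def B_def)
  then have "k * (4 / (1 + A\<^sup>2 + B\<^sup>2)\<^sup>2) \<le> exp (2 * u (x0 + y0))"
    unfolding sum.distrib sum_distrib_left[symmetric] log_barrier_laplacian[OF ab(3-5)] eq by simp
  also have "exp (2 * u (x0 + y0)) \<le> k / (1 + A\<^sup>2 + B\<^sup>2)\<^sup>2"
  proof -
    define s where "s = norm y0"
    have s: "s \<ge> 0" by (simp add: s_def)
    have "\<kappa> * (1 + A\<^sup>2 + B\<^sup>2) \<le> \<kappa> * (1 + s\<^sup>2)"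
      using q_le[of y0] \<kappa> by (intro mult_left_mono) (auto simp: q_def A_def B_def s_def)
    also have "\<dots> \<le> 1 + c\<^sup>2 / 2 * s\<^sup>2"
      using mult_right_mono[of \<kappa> "c\<^sup>2 / 2" "s\<^sup>2"] \<kappa>_le by (simp add: distrib_left)
    also have "\<dots> \<le> exp (c * s)"
      using exp_lower_Taylor_quadratic[of "c * s"] s decay(1)
      by (smt (verit) mult_nonneg_nonneg power_mult_distrib times_divide_eq_left)
    finally have "(\<kappa> * (1 + A\<^sup>2 + B\<^sup>2))\<^sup>2 \<le> (exp (c * s))\<^sup>2"
      using \<kappa> by (intro power_mono) auto
    then have 1: "\<kappa>\<^sup>2 * (1 + A\<^sup>2 + B\<^sup>2)\<^sup>2 \<le> exp (2 * (c * s))"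
      by (simp add: power_mult_distrib exp_double)
    have "1 + A\<^sup>2 + B\<^sup>2 > 0"
      by (simp add: add_pos_nonneg)
    then have pos: "\<kappa>\<^sup>2 * (1 + A\<^sup>2 + B\<^sup>2)\<^sup>2 > 0"
      using \<kappa> by simp
    have "exp (2 * u (x0 + y0)) \<le> exp (2 * C - 2 * (c * s))"
      using decay(2)[of y0] y0(1) by (simp add: S_def s_def)
    also have "\<dots> = exp (2 * C) / exp (2 * (c * s))"
      by (rule exp_diff)
    also have "\<dots> \<le> exp (2 * C) / (\<kappa>\<^sup>2 * (1 + A\<^sup>2 + B\<^sup>2)\<^sup>2)"
      using 1 pos by (intro divide_left_mono) auto
    finally show ?thesis
      by (simp add: k_def)
  qed
  finally have "k * (4 / (1 + A\<^sup>2 + B\<^sup>2)\<^sup>2) \<le> k / (1 + A\<^sup>2 + B\<^sup>2)\<^sup>2" .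
  moreover have "1 + A\<^sup>2 + B\<^sup>2 > 0"
    by (simp add: add_pos_nonneg)
  ultimately show False
    using k by (simp add: field_simps)
qed

section \<open>Reduction to one variable\<close>

lemma is_solution_facts:
  assumes "is_solution u"
  shows is_solution_differentiable: "u differentiable (at x)"
    and is_solution_pure_partials:
      "has_pure_partials u (\<lambda>i. partial_deriv i u) (\<lambda>i. partial_deriv i (partial_deriv i u))"
    and is_solution_laplacian: "(\<Sum>i\<in>UNIV. partial_deriv i (partial_deriv i u) x) = - exp (2 * u x)"
proof -
  show "u differentiable (at x)"
    using assms by (simp add: is_solution_def C2_def C1_def)
  show "has_pure_partials u (\<lambda>i. partial_deriv i u) (\<lambda>i. partial_deriv i (partial_deriv i u))"
    using assms by (simp add: is_solution_def C2_has_pure_partials)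
  have "- laplacian u x = exp (2 * u x)"
    using assms by (simp add: is_solution_def)
  then show "(\<Sum>i\<in>UNIV. partial_deriv i (partial_deriv i u) x) = - exp (2 * u x)"
    unfolding laplacian_def by linarith
qed

text \<open>For \<open>s \<ge> 0\<close> the increment \<open>u (y + s e) - u y\<close> is nonnegative,
so monotonicity of the exponential makes it superharmonic; it vanishes at \<open>x0\<close>, hence
everywhere. Working with this difference in place of the directional derivative avoids a third
derivative of \<open>u\<close>.\<close>
lemma invariant_along_ray_of_maxima:
  fixes u :: "real ^ 'n \<Rightarrow> real"
  assumes sol: "is_solution u"
    and conc: "concave_on UNIV u"
    and max: "\<And>y. u y \<le> u x0"
    and ray: "\<And>t. t \<ge> 0 \<Longrightarrow> u (x0 + t *\<^sub>R e) = u x0"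
  shows "u (x + t *\<^sub>R e) = u x"
proof -
  have cont: "continuous_on UNIV u"
    using is_solution_differentiable[OF sol]
    by (simp add: continuous_at_imp_continuous_on differentiable_imp_continuous_within)
  have nonneg_case: "u (x + s *\<^sub>R e) = u x" if "s \<ge> 0" for s x
  proof -
    define w where "w y = u (y + s *\<^sub>R e) + (-1) * u y" for y
    have mono: "u y \<le> u (y + s *\<^sub>R e)" for y
      using ray that by (intro concave_nondecreasing_along_ray_of_maxima[OF conc cont max]) auto
    have "w x = 0"
    proof (rule strong_minimum_principle)
      show "has_pure_partials w
          (\<lambda>i y. partial_deriv i u (y + s *\<^sub>R e) + (-1) * partial_deriv i u y)
          (\<lambda>i y. partial_deriv i (partial_deriv i u) (y + s *\<^sub>R e) + (-1) * partial_deriv i (partial_deriv i u) y)"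
        unfolding w_def
        by (intro has_pure_partials_add_scaled has_pure_partials_translate is_solution_pure_partials[OF sol])
      show "w differentiable (at y)" for y
        unfolding w_def
        by (intro differentiable_add differentiable_mult differentiable_const
            is_solution_differentiable[OF sol] differentiable_chain_at[of "\<lambda>y. y + s *\<^sub>R e" _ u, unfolded o_def]
            differentiable_ident)
      show "(\<Sum>i\<in>UNIV. partial_deriv i (partial_deriv i u) (y + s *\<^sub>R e)
          + (-1) * partial_deriv i (partial_deriv i u) y) \<le> 0" for y
        unfolding sum.distrib sum_distrib_left[symmetric] is_solution_laplacian[OF sol]
        using mono[of y] by simp
      show "w y \<ge> 0" for y
        using mono[of y] by (simp add: w_def)
      show "w x0 = 0"
        using ray[OF that] by (simp add: w_def)
    qed
    then show ?thesis
      by (simp add: w_def)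
  qed
  show ?thesis
    using nonneg_case[of t x] nonneg_case[of "- t" "x + t *\<^sub>R e"] by (cases "t \<ge> 0") auto
qed

text \<open>Let \<open>L\<close> be the space of all directions in which \<open>u\<close> is invariant.
No direction in its orthogonal complement spans a ray of maxima, so \<open>u\<close> decays linearly
there, which excludes two orthonormal directions. The complement is not trivial either, since a constant
is not a solution; so it is a line.\<close>
lemma solution_one_dimensional:
  fixes u :: "real ^ 'n \<Rightarrow> real"
  assumes sol: "is_solution u"
    and conc: "concave_on UNIV u"
    and max: "\<And>y. u y \<le> u x0"
  obtains a where "norm a = 1" "\<And>x. u x = u ((a \<bullet> x) *\<^sub>R a)"
proof -
  have cont: "continuous_on UNIV u"
    using is_solution_differentiable[OF sol]
    by (simp add: continuous_at_imp_continuous_on differentiable_imp_continuous_within)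
  define L where "L = {e. \<forall>x t. u (x + t *\<^sub>R e) = u x}"
  have L: "subspace L"
    unfolding subspace_def L_def
    by (auto simp: scaleR_add_right add.assoc[symmetric])
  define V where "V = L\<^sup>\<bottom>"
  have V: "subspace V"
    by (simp add: V_def subspace_orthogonal_comp)
  have decomp: "\<exists>y\<in>V. x - y \<in> L" for x
  proof -
    obtain l y where "l \<in> span L" "\<And>w. w \<in> span L \<Longrightarrow> orthogonal y w" "x = l + y"
      using orthogonal_subspace_decomp_exists[of L x] by blast
    moreover have "span L = L" using L by (simp add: span_eq_iff)
    ultimately show ?thesis
      by (intro bexI[of _ y]) (auto simp: V_def orthogonal_comp_def orthogonal_commute)
  qed
  have trivial: "e = 0" if "e \<in> L" "e \<in> V" for e
    using that by (auto simp: V_def orthogonal_comp_def orthogonal_def)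
  have L_inv: "u (x + l) = u x" if "l \<in> L" for x l
    using that by (auto simp: L_def dest!: spec[of _ 1] spec[of _ x])
  obtain c C where decay: "c > 0" "\<And>y. y \<in> V \<Longrightarrow> u (x0 + y) \<le> C - c * norm y"
  proof (rule concave_linear_decay[OF conc cont max V])
    fix e assume e: "e \<in> V" "norm e = 1"
    show "\<exists>t\<ge>0. u (x0 + t *\<^sub>R e) \<noteq> u x0"
    proof (rule ccontr)
      assume "\<not> ?thesis"
      then have "e \<in> L"
        using invariant_along_ray_of_maxima[OF sol conc max, of e] by (auto simp: L_def)
      then show False
        using trivial e by force
    qed
  qed blast
  have no_pair: False if "a \<in> V" "b \<in> V" "norm a = 1" "norm b = 1" "a \<bullet> b = 0" for a b
  proof (rule no_linear_decay_in_two_directions[OF is_solution_pure_partials[OF sol]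
        is_solution_laplacian[OF sol] cont V _ decay that])
    fix x
    obtain y where y: "y \<in> V" "x - x0 - y \<in> L"
      using decomp by blast
    have "v \<bullet> (x - x0) = v \<bullet> y" if "v \<in> V" for v
    proof -
      have "v \<bullet> (x - x0 - y) = 0"
        using that y(2) by (auto simp: V_def orthogonal_comp_def orthogonal_def inner_commute)
      then show ?thesis by (simp add: inner_diff_right)
    qed
    moreover have "u x = u (x0 + y)"
      using L_inv[OF y(2), of "x0 + y"] by (simp add: algebra_simps)
    ultimately show "\<exists>y\<in>V. (\<forall>v\<in>V. v \<bullet> (x - x0) = v \<bullet> y) \<and> u x = u (x0 + y)"
      using y(1) by blast
  qed
  have "\<exists>v\<in>V. v \<noteq> 0"
  proof (rule ccontr)
    assume "\<not> ?thesis"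
    then have const: "u x = u 0" for x
    proof -
      obtain y where "y \<in> V" "x - y \<in> L" using decomp by blast
      then show ?thesis using \<open>\<not> (\<exists>v\<in>V. v \<noteq> 0)\<close> L_inv[of x 0] by auto
    qed
    have "partial_deriv i (partial_deriv i u) x = 0" for i x
    proof -
      have "u = (\<lambda>x. u 0)" by (rule ext) (rule const)
      then have "partial_deriv i u = (\<lambda>x. 0)" for i
        unfolding partial_deriv_def by (metis frechet_derivative_const)
      then show ?thesis
        by (simp add: partial_deriv_def frechet_derivative_const)
    qed
    then show False
      using is_solution_laplacian[OF sol, of 0] by simp
  qed
  then obtain v where v: "v \<in> V" "v \<noteq> 0" by blast
  define a where "a = (1 / norm v) *\<^sub>R v"
  have a: "a \<in> V" "norm a = 1"
    using v V by (auto simp: a_def subspace_scale)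
  have V_line: "y = (a \<bullet> y) *\<^sub>R a" if "y \<in> V" for y
  proof (rule ccontr)
    define d where "d = y - (a \<bullet> y) *\<^sub>R a"
    assume "y \<noteq> (a \<bullet> y) *\<^sub>R a"
    then have "d \<noteq> 0" by (simp add: d_def)
    have "d \<in> V" using V a that by (simp add: d_def subspace_diff subspace_scale)
    moreover have "a \<bullet> d = 0"
      using a by (simp add: d_def inner_diff_right norm_eq_1)
    ultimately show False
      using no_pair[of a "(1 / norm d) *\<^sub>R d"] a V \<open>d \<noteq> 0\<close> by (simp add: subspace_scale)
  qed
  have "u x = u ((a \<bullet> x) *\<^sub>R a)" for x
  proof -
    obtain y where y: "y \<in> V" "x - y \<in> L"
      using decomp by blast
    have "a \<bullet> (x - y) = 0"
      using a y(2) by (auto simp: V_def orthogonal_comp_def orthogonal_def inner_commute)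
    then have "y = (a \<bullet> x) *\<^sub>R a"
      using V_line[OF y(1)] by (simp add: inner_diff_right)
    then show ?thesis
      using L_inv[OF y(2), of y] by simp
  qed
  then show thesis
    using that a by blast
qed

text \<open>Along an axis \<open>k\<close> with \<open>a $ k \<noteq> 0\<close> the solution is a
rescaled copy of its profile, which makes the profile twice differentiable. Then on an arbitrary axis
\<open>i\<close> the second partial is the second derivative of the profile times \<open>(a $
i)\<^sup>2\<close>, and these squares add up to \<open>1\<close>.\<close>
lemma profile_solves_ode:
  fixes u :: "real ^ 'n \<Rightarrow> real"
  assumes sol: "is_solution u"
    and a: "norm a = 1" "\<And>x. u x = u ((a \<bullet> x) *\<^sub>R a)"
  obtains f' where "\<And>t. ((\<lambda>t. u (t *\<^sub>R a)) has_real_derivative f' t) (at t)"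
    and "\<And>t. (f' has_real_derivative - exp (2 * u (t *\<^sub>R a))) (at t)"
proof -
  note pp = is_solution_pure_partials[OF sol]
  define f where "f t = u (t *\<^sub>R a)" for t
  have uf: "u x = f (a \<bullet> x)" for x
    using a(2)[of x] by (simp add: f_def)
  obtain k where k: "a $ k \<noteq> 0"
    using a(1) by (metis norm_zero vec_eq_iff zero_index zero_neq_one)
  have slice: "a \<bullet> (x + t *\<^sub>R axis i 1) = a \<bullet> x + t * a $ i" for x t i
    by (simp add: inner_add_right inner_axis)
  have aa: "a \<bullet> (t *\<^sub>R a) = t" for t
    using a(1) by (simp add: norm_eq_1)
  define p where "p t = t *\<^sub>R axis k (1 / a $ k)" for t
  have p: "a \<bullet> p t = t" for t
    using k by (simp add: p_def inner_axis)
  define f' where "f' t = partial_deriv k u (p t) / a $ k" for t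
  define f'' where "f'' t = partial_deriv k (partial_deriv k u) (p t) / (a $ k)\<^sup>2" for t
  have reparam: "p s = 0 + (s / a $ k) *\<^sub>R axis k 1" for s
    by (simp add: p_def vec_eq_iff axis_def)
  have scale: "((\<lambda>s::real. s / a $ k) has_real_derivative 1 / a $ k) (at s)" for s
    using k by (auto intro!: derivative_eq_intros)
  have f1: "(f has_real_derivative f' t) (at t)" for t
  proof -
    have "((\<lambda>s. u (0 + (s / a $ k) *\<^sub>R axis k 1)) has_real_derivative
        partial_deriv k u (0 + (t / a $ k) *\<^sub>R axis k 1) * (1 / a $ k)) (at t)"
      by (rule DERIV_chain2[OF has_pure_partials_slice(1)[OF pp] scale])
    then show ?thesis
      unfolding reparam[symmetric] uf p f'_def by simp
  qed
  have f2: "(f' has_real_derivative f'' t) (at t)" for t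
  proof -
    have "((\<lambda>s. partial_deriv k u (0 + (s / a $ k) *\<^sub>R axis k 1) / a $ k) has_real_derivative
        partial_deriv k (partial_deriv k u) (0 + (t / a $ k) *\<^sub>R axis k 1) * (1 / a $ k) / a $ k) (at t)"
      by (rule DERIV_cdivide[OF DERIV_chain2[OF has_pure_partials_slice(2)[OF pp] scale]])
    then show ?thesis
      unfolding reparam[symmetric] f'_def f''_def by (simp add: power2_eq_square)
  qed
  have lin: "((\<lambda>t. a \<bullet> x + t * a $ i) has_real_derivative a $ i) (at t)" for x i t
    by (auto intro!: derivative_eq_intros)
  have g: "partial_deriv i u x = f' (a \<bullet> x) * a $ i" for i x
  proof -
    have "((\<lambda>t. f (a \<bullet> x + t * a $ i)) has_real_derivative f' (a \<bullet> x + 0 * a $ i) * a $ i) (at 0)"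
      by (rule DERIV_chain2[OF f1 lin])
    moreover have "((\<lambda>t. f (a \<bullet> x + t * a $ i)) has_real_derivative partial_deriv i u x) (at 0)"
      using has_pure_partials_slice(1)[OF pp, of x i 0] unfolding uf slice by simp
    ultimately show ?thesis
      using DERIV_unique by fastforce
  qed
  have h: "partial_deriv i (partial_deriv i u) x = f'' (a \<bullet> x) * (a $ i)\<^sup>2" for i x
  proof -
    have "((\<lambda>t. f' (a \<bullet> x + t * a $ i) * a $ i) has_real_derivative f'' (a \<bullet> x + 0 * a $ i) * a $ i * a $ i) (at 0)"
      by (rule DERIV_cmult_right[OF DERIV_chain2[OF f2 lin]])
    moreover have "((\<lambda>t. f' (a \<bullet> x + t * a $ i) * a $ i) has_real_derivative partial_deriv i (partial_deriv i u) x) (at 0)"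
      using has_pure_partials_slice(2)[OF pp, of i x 0] unfolding g slice by simp
    ultimately show ?thesis
      using DERIV_unique by (fastforce simp: power2_eq_square mult.assoc)
  qed
  have f'': "f'' t = - exp (2 * f t)" for t
  proof -
    have "(\<Sum>i\<in>UNIV. (a $ i)\<^sup>2) = 1"
      using a(1) by (simp add: norm_eq_1 inner_vec_def power2_eq_square)
    then show ?thesis
      using is_solution_laplacian[OF sol, of "t *\<^sub>R a"]
      unfolding h aa sum_distrib_left[symmetric] by (simp add: f_def)
  qed
  show thesis
    by (rule that[of f', folded f_def, OF f1 f2[unfolded f'']])
qed

section \<open>The classification\<close>

theorem theorem1p10:
  fixes u :: "real ^ 'n::{finite,linorder} \<Rightarrow> real"
    and x0 :: "real ^ 'n::{finite,linorder}"
  assumes "CARD('n) \<ge> 2"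
    and "concave_on UNIV u"
    and "is_solution u"
    and "has_local_max_at u x0"
  shows "\<exists>l R b. l > 0 \<and> rotation_matrix R \<and>
           (\<forall>x. u x = ln l + U_sech (l *\<^sub>R (R *v x) + b))"
proof -
  have max: "u y \<le> u x0" for y
  proof -
    obtain e where "e > 0" "\<forall>y. dist y x0 < e \<longrightarrow> u y \<le> u x0"
      using assms(4) unfolding has_local_max_at_def eventually_nhds_metric by blast
    then have "\<forall>y\<in>UNIV. - u x0 \<le> - u y"
      using convex_local_global_minimum[of e UNIV "\<lambda>y. - u y" x0] assms(2)
      unfolding concave_on_def by (auto simp: dist_commute)
    then show ?thesis by simp
  qed
  obtain a where a: "norm a = 1" "\<And>x. u x = u ((a \<bullet> x) *\<^sub>R a)"
    using solution_one_dimensional[OF assms(3,2) max] by blast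
  obtain f' where f1: "\<And>t. ((\<lambda>t. u (t *\<^sub>R a)) has_real_derivative f' t) (at t)"
    and f2: "\<And>t. (f' has_real_derivative - exp (2 * u (t *\<^sub>R a))) (at t)"
    using profile_solves_ode[OF assms(3) a] by blast
  define t0 where "t0 = a \<bullet> x0"
  have "f' t0 = 0"
    using max a(2)[of x0] by (intro DERIV_local_max[OF f1[of t0], of 1]) (auto simp: t0_def)
  define l where "l = exp (u x0)"
  have profile: "u x = ln l + ln (sech (l * (a \<bullet> x - t0)))" for x
    using ode_with_critical_point[OF f1 f2 \<open>f' t0 = 0\<close>, of "a \<bullet> x"] a(2)[of x] a(2)[of x0]
    by (simp add: l_def t0_def)
  define m :: 'n where "m = Max UNIV"
  obtain A where A: "rotation_matrix A" "A *v axis m 1 = a"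
    using rotation_matrix_exists_basis[OF assms(1) a(1)] by blast
  \<comment> \<open>the inverse of \<open>A\<close>: the rotation taking \<open>a\<close> to the last basis vector\<close>
  define R where "R = transpose A"
  have R: "rotation_matrix R"
    using A(1) by (simp add: R_def rotation_matrix_def orthogonal_matrix_transpose)
  have Rm: "(R *v x) $ m = a \<bullet> x" for x
  proof -
    have "(R *v x) $ m = axis m 1 \<bullet> (R *v x)"
      by (simp add: inner_axis')
    also have "\<dots> = a \<bullet> x"
      by (metis A(2) R_def dot_lmul_matrix inner_commute transpose_matrix_vector)
    finally show ?thesis .
  qed
  have "u x = ln l + U_sech (l *\<^sub>R (R *v x) + (- l * t0) *\<^sub>R axis m 1)" for x
    unfolding profile U_sech_def m_def[symmetric]
    by (simp add: Rm algebra_simps)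
  moreover have "l > 0" by (simp add: l_def)
  ultimately show ?thesis
    using R by blast
qed

end
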